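(* Let $\mathbb{F}$ be an algebraically closed field of characteristic not $2$ or $3$, let $\mathfrak{g}$ be a semisimple Lie algebra over $\mathbb{F}$, and let $\phi:\mathfrak{g}\to\mathfrak{gl}(\mathbb{F}^n)$ be a faithful irreducible representation, with image $\mathcal{B}=\phi(\mathfrak{g})\leq \mathrm{M}(n,\mathbb{F})$. Then $\mathcal{B}$ admits a linear kernel vector if and only if $\mathcal{B}$ is trivial, or $\mathfrak{g}$ is simple and $\phi$ is isomorphic to the adjoint representation of $\mathfrak{g}$.
   Context: A linear kernel vector of a matrix space $\mathcal{B}\leq\mathrm{M}(n,\mathbb{F})$ is a non-zero linear map $\psi:\mathcal{B}\to\mathbb{F}^n$ such that $\psi(A)^tA=0$ for every $A\in\mathcal{B}$. "$\mathcal{B}$ is trivial" means $\mathcal{B}$ is the trivial irreducible matrix Lie algebra $\{0\}\leq\mathrm{M}(1,\mathbb{F})$. The adjoint representation is $\mathrm{ad}:\mathfrak{g}\to\mathfrak{gl}(\mathfrak{g})$, $\mathrm{ad}_x(y)=[x,y]$.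
   Formalization: Semisimple is taken to exclude g = 0, since {0} has no non-zero linear map and the trivial case fails; the matrices of φ(g) act on row vectors, since with columns the coadjoint representation of the Witt algebra (characteristic at least 5) is a counterexample. *)

theory Defs
  imports "HOL-Analysis.Analysis"
begin

text \<open>
  A Lie algebra occupies the whole type \<open>'g\<close>. Finite-dimensionality is not assumed: it is
  automatic for a Lie algebra with a faithful representation on \<open>'a ^ 'n\<close>.
\<close>

locale lie_algebra = vector_space scale
  for scale :: "'a::field \<Rightarrow> 'g::ab_group_add \<Rightarrow> 'g" +
  fixes bracket :: "'g \<Rightarrow> 'g \<Rightarrow> 'g"
  assumes bracket_add_left: "bracket (x + y) z = bracket x z + bracket y z"
    and bracket_add_right: "bracket x (y + z) = bracket x y + bracket x z"
    and bracket_scale_left: "bracket (scale c x) y = scale c (bracket x y)"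
    and bracket_scale_right: "bracket x (scale c y) = scale c (bracket x y)"
    and bracket_self: "bracket x x = 0"
    and jacobi: "bracket x (bracket y z) + bracket y (bracket z x) + bracket z (bracket x y) = 0"
begin

definition ideal :: "'g set \<Rightarrow> bool" where
  "ideal I \<longleftrightarrow> subspace I \<and> (\<forall>x. \<forall>y\<in>I. bracket x y \<in> I)"

definition derived :: "'g set \<Rightarrow> 'g set" where
  "derived S = span {bracket x y | x y. x \<in> S \<and> y \<in> S}"

definition solvable :: "'g set \<Rightarrow> bool" where
  "solvable S \<longleftrightarrow> (\<exists>k. (derived ^^ k) S = {0})"

text \<open>
  The zero Lie algebra is not counted as semisimple. A zero radical means that there is
  no non-zero solvable ideal; this is the definition in every characteristic.
\<close>

definition semisimple :: bool where
  "semisimple \<longleftrightarrow> (\<exists>x::'g. x \<noteq> 0) \<and> (\<forall>I. ideal I \<and> solvable I \<longrightarrow> I = {0})"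

definition simple :: bool where
  "simple \<longleftrightarrow> (\<exists>x y. bracket x y \<noteq> 0) \<and> (\<forall>I. ideal I \<longrightarrow> I = {0} \<or> I = UNIV)"

definition ad :: "'g \<Rightarrow> 'g \<Rightarrow> 'g" where
  "ad x y = bracket x y"

end

locale lie_representation = lie_algebra scale bracket + V: vector_space scaleV
  for scale :: "'a::field \<Rightarrow> 'g::ab_group_add \<Rightarrow> 'g"
    and bracket :: "'g \<Rightarrow> 'g \<Rightarrow> 'g"
    and scaleV :: "'a \<Rightarrow> 'v::ab_group_add \<Rightarrow> 'v" +
  fixes \<phi> :: "'g \<Rightarrow> 'v \<Rightarrow> 'v"
  assumes rep_linear: "Vector_Spaces.linear scaleV scaleV (\<phi> x)"
    and rep_add: "\<phi> (x + y) v = \<phi> x v + \<phi> y v"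
    and rep_scale: "\<phi> (scale c x) v = scaleV c (\<phi> x v)"
    and rep_bracket: "\<phi> (bracket x y) v = \<phi> x (\<phi> y v) - \<phi> y (\<phi> x v)"
begin

definition faithful :: bool where
  "faithful \<longleftrightarrow> inj \<phi>"

definition irreducible_rep :: bool where
  "irreducible_rep \<longleftrightarrow> (\<exists>v::'v. v \<noteq> 0) \<and>
     (\<forall>W. V.subspace W \<and> (\<forall>x. \<forall>w\<in>W. \<phi> x w \<in> W) \<longrightarrow> W = {0} \<or> W = UNIV)"

end

definition rep_isomorphic ::
  "('a::field \<Rightarrow> 'v::ab_group_add \<Rightarrow> 'v) \<Rightarrow> ('g \<Rightarrow> 'v \<Rightarrow> 'v) \<Rightarrow>
   ('a \<Rightarrow> 'w::ab_group_add \<Rightarrow> 'w) \<Rightarrow> ('g \<Rightarrow> 'w \<Rightarrow> 'w) \<Rightarrow> bool" where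
  "rep_isomorphic scaleV \<phi> scaleW \<rho> \<longleftrightarrow>
     (\<exists>f. Vector_Spaces.linear scaleV scaleW f \<and> bij f \<and> (\<forall>x v. f (\<phi> x v) = \<rho> x (f v)))"

lemma (in lie_algebra) adjoint_representation: "lie_representation scale bracket scale ad"
proof -
  have skew: "bracket x y = - bracket y x" for x y
    using bracket_self[of "x + y"] bracket_self[of x] bracket_self[of y]
    by (simp add: bracket_add_left bracket_add_right eq_neg_iff_add_eq_0 add.commute)
  have neg: "bracket x (- y) = - bracket x y" for x y
    using bracket_scale_right[of x "-1" y] by simp
  have "bracket (bracket x y) v = bracket x (bracket y v) - bracket y (bracket x v)" for x y v
  proof -
    have "bracket y (bracket v x) = - bracket y (bracket x v)"
      by (metis skew neg)
    moreover have "bracket v (bracket x y) = - bracket (bracket x y) v"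
      by (rule skew)
    ultimately show ?thesis
      using jacobi[of x y v] by (simp add: algebra_simps)
  qed
  then show ?thesis
    by unfold_locales
      (simp_all add: ad_def bracket_add_left bracket_add_right bracket_scale_left
        bracket_scale_right)
qed

text \<open>
  The equation \<open>\<psi>(A)\<^sup>t A = 0\<close> says that \<open>A\<close>, acting on row vectors by \<open>v\<^sup>t \<mapsto> v\<^sup>t A\<close>,
  kills \<open>\<psi>(A)\<close>. Accordingly an endomorphism of \<open>'a ^ 'n\<close> is identified with its matrix for
  that action, characterised by \<open>v v* row_matrix T = T v\<close> (below), and the image of a
  representation in \<open>M(n,F)\<close> is taken under this identification. With the action on columns
  the equation would describe the dual of \<open>\<phi>\<close> instead. For Lie algebras whose adjoint
  representation is self-dual this makes no difference, but in characteristic \<open>p \<ge> 5\<close> the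
  coadjoint representation of the simple Witt algebra, which is not isomorphic to the
  adjoint one, would satisfy it.
\<close>

definition row_matrix :: "('a::field ^ 'n \<Rightarrow> 'a ^ 'n) \<Rightarrow> 'a ^ 'n ^ 'n" where
  "row_matrix T = transpose (matrix T)"

lemma row_matrix_works:
  assumes "Vector_Spaces.linear (*s) (*s) T"
  shows "v v* row_matrix T = T v"
  using matrix_works[OF assms] by (simp add: row_matrix_def)

definition rep_image :: "('g \<Rightarrow> 'a::field ^ 'n \<Rightarrow> 'a ^ 'n) \<Rightarrow> ('a ^ 'n ^ 'n) set" where
  "rep_image \<phi> = range (\<lambda>x. row_matrix (\<phi> x))"

text \<open>
  A linear map on a matrix space \<open>B\<close> is rendered by a total function of which only the
  values on \<open>B\<close> matter. The matrix \<open>\<chi> i. c *s (A $ i)\<close> is the scalar multiple \<open>c A\<close>.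
\<close>

definition linear_kernel_vector ::
  "('a::field ^ 'n ^ 'n) set \<Rightarrow> ('a ^ 'n ^ 'n \<Rightarrow> 'a ^ 'n) \<Rightarrow> bool" where
  "linear_kernel_vector B \<psi> \<longleftrightarrow>
     (\<forall>A\<in>B. \<forall>C\<in>B. \<psi> (A + C) = \<psi> A + \<psi> C) \<and>
     (\<forall>c. \<forall>A\<in>B. \<psi> (\<chi> i. c *s (A $ i)) = c *s \<psi> A) \<and>
     (\<exists>A\<in>B. \<psi> A \<noteq> 0) \<and>
     (\<forall>A\<in>B. \<psi> A v* A = 0)"

definition trivial_matrix_lie_algebra :: "('a::field ^ 'n ^ 'n) set \<Rightarrow> bool" where
  "trivial_matrix_lie_algebra B \<longleftrightarrow> CARD('n) = 1 \<and> B = {0}"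

end

theory Submission
  imports Defs
begin

text \<open>
  View a kernel vector as a linear map \<open>\<psi> : \<gg> \<rightarrow> V\<close> with \<open>x \<psi>(x) = 0\<close>. Such maps form a
  submodule of \<open>Hom(\<gg>, V)\<close>, and \<open>\<psi>\<close> is a homomorphism of \<open>\<gg>\<close>-modules exactly when
  \<open>(x.\<psi>)(y) = x \<psi>(y) - \<psi>[x, y]\<close> vanishes. The expression \<open>T\<^sub>\<psi>(x, y, z) = x (y.\<psi>)(z)\<close> is
  alternating, and in characteristic other than \<open>2\<close> the alternating sum of \<open>w T\<^sub>\<psi>(x, y, z)\<close>
  is zero. This gives \<open>T\<^bsub>u.\<psi>\<^esub> = - u T\<^sub>\<psi>\<close>, so \<open>[u, v] T\<^sub>\<psi> = T\<^bsub>[u, v].\<psi>\<^esub> = - [u, v] T\<^sub>\<psi>\<close> and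
  \<open>[\<gg>, \<gg>]\<close> kills all values of \<open>T\<^sub>\<psi>\<close>. If \<open>\<gg>\<close> is not abelian and \<open>V\<close> is irreducible and
  faithful, then \<open>T\<^sub>\<psi> = 0\<close>, hence \<open>x.\<psi> = 0\<close>. So \<open>\<psi>\<close> is a homomorphism, and by irreducibility
  and faithfulness it is an isomorphism from the adjoint module to \<open>V\<close>.
\<close>

section \<open>Bracket identities and semisimplicity\<close>

context lie_algebra
begin

lemma bracket_skew: "bracket x y = - bracket y x"
  using bracket_self[of "x + y"] bracket_self[of x] bracket_self[of y]
  by (simp add: bracket_add_left bracket_add_right eq_neg_iff_add_eq_0 add.commute)

lemma bracket_minus_right: "bracket x (- y) = - bracket x y"
  using bracket_scale_right[of x "-1" y] by simp

lemma bracket_bracket_left: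
  "bracket (bracket x y) z = bracket x (bracket y z) - bracket y (bracket x z)"
proof -
  have "bracket y (bracket z x) = - bracket y (bracket x z)"
    by (metis bracket_skew bracket_minus_right)
  moreover have "bracket z (bracket x y) = - bracket (bracket x y) z"
    by (rule bracket_skew)
  ultimately show ?thesis
    using jacobi[of x y z] by (simp add: algebra_simps)
qed

text \<open>In an abelian algebra the whole algebra is a solvable ideal, so a zero radical would
  force it to be zero.\<close>

lemma semisimple_nonabelian:
  assumes semisimple
  shows "\<exists>x y. bracket x y \<noteq> 0"
proof (rule ccontr)
  assume "\<nexists>x y. bracket x y \<noteq> 0"
  then have br: "bracket x y = 0" for x y by blast
  have "derived UNIV = {0}"
    by (simp add: derived_def br)
  then have "(derived ^^ 1) UNIV = {0}" by simp
  then have "solvable UNIV" unfolding solvable_def by blast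
  moreover have "ideal UNIV" by (simp add: ideal_def)
  ultimately have "(UNIV :: 'g set) = {0}"
    using assms unfolding semisimple_def by blast
  then show False
    using assms unfolding semisimple_def by blast
qed

end

section \<open>Modules and their invariants\<close>

context lie_representation
begin

lemma rep_add_right: "\<phi> x (v + w) = \<phi> x v + \<phi> x w"
proof -
  interpret L: Vector_Spaces.linear scaleV scaleV "\<phi> x" by (rule rep_linear)
  show ?thesis by (rule L.add)
qed

lemma rep_scale_right: "\<phi> x (scaleV c v) = scaleV c (\<phi> x v)"
proof -
  interpret L: Vector_Spaces.linear scaleV scaleV "\<phi> x" by (rule rep_linear)
  show ?thesis by (rule L.scale)
qed

lemma rep_zero_right [simp]: "\<phi> x 0 = 0"
  using rep_add_right[of x 0 0] by simp

lemma rep_minus_right: "\<phi> x (- v) = - \<phi> x v"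
  using rep_add_right[of x v "- v"] by (simp add: eq_neg_iff_add_eq_0 add.commute)

lemma rep_diff_right: "\<phi> x (v - w) = \<phi> x v - \<phi> x w"
  using rep_add_right[of x v "- w"] by (simp add: rep_minus_right)

lemma rep_zero_left [simp]: "\<phi> 0 v = 0"
  using rep_add[of 0 0 v] by simp

lemma faithful_eq_zero:
  assumes faithful "\<And>v. \<phi> x v = 0"
  shows "x = 0"
proof -
  have "\<phi> x = \<phi> 0" using assms(2) by auto
  then show ?thesis using assms(1) by (simp add: faithful_def inj_eq)
qed

lemma irreducible_subspace_cases:
  assumes irreducible_rep "V.subspace W" "\<And>x w. w \<in> W \<Longrightarrow> \<phi> x w \<in> W"
  shows "W = {0} \<or> W = UNIV"
  using assms unfolding irreducible_rep_def by blast

text \<open>The invariants form a submodule; were it all of V, then \<open>bracket a b\<close> would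
  act as zero, against faithfulness.\<close>

lemma invariants_zero:
  assumes irr: irreducible_rep and faithful and nab: "bracket a b \<noteq> 0"
    and v: "\<And>x. \<phi> x v = 0"
  shows "v = 0"
proof -
  let ?W = "{w. \<forall>x. \<phi> x w = 0}"
  have "V.subspace ?W"
    by (auto simp: V.subspace_def rep_add_right rep_scale_right)
  then have "?W = {0} \<or> ?W = UNIV"
    by (rule irreducible_subspace_cases[OF irr]) simp
  moreover have "?W \<noteq> UNIV"
  proof
    assume "?W = UNIV"
    then have "\<phi> (bracket a b) w = 0" for w by blast
    with \<open>faithful\<close> have "bracket a b = 0" by (rule faithful_eq_zero)
    with nab show False by simp
  qed
  ultimately show ?thesis using v by blast
qed

lemma derived_invariants_zero:
  assumes irr: irreducible_rep and faithful and nab: "bracket a b \<noteq> 0"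
    and v: "\<And>x y. \<phi> (bracket x y) v = 0"
  shows "v = 0"
proof -
  let ?W = "{w. \<forall>x y. \<phi> (bracket x y) w = 0}"
  have "V.subspace ?W"
    by (auto simp: V.subspace_def rep_add_right rep_scale_right)
  moreover have "\<phi> z w \<in> ?W" if "w \<in> ?W" for z w
  proof -
    \<comment> \<open>[x, y] z w = [[x, y], z] w + z [x, y] w, and [[x, y], z] is again a
      bracket.\<close>
    have "\<phi> (bracket x y) (\<phi> z w) = 0" for x y
      using that rep_bracket[of "bracket x y" z w] by simp
    then show ?thesis by simp
  qed
  ultimately have "?W = {0} \<or> ?W = UNIV"
    using irr by (intro irreducible_subspace_cases) auto
  moreover have "?W \<noteq> UNIV"
  proof
    assume "?W = UNIV"
    then have "\<phi> (bracket a b) w = 0" for w by blast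
    with \<open>faithful\<close> have "bracket a b = 0" by (rule faithful_eq_zero)
    with nab show False by simp
  qed
  ultimately show ?thesis using v by blast
qed

section \<open>Kernel maps and the action on Hom(g, V)\<close>

definition hom_act :: "'g \<Rightarrow> ('g \<Rightarrow> 'v) \<Rightarrow> 'g \<Rightarrow> 'v" where
  "hom_act x \<psi> y = \<phi> x (\<psi> y) - \<psi> (bracket x y)"

definition kernel_map :: "('g \<Rightarrow> 'v) \<Rightarrow> bool" where
  "kernel_map \<psi> \<longleftrightarrow> (\<forall>x y. \<psi> (x + y) = \<psi> x + \<psi> y) \<and> (\<forall>x. \<phi> x (\<psi> x) = 0)"

definition kernel_form :: "('g \<Rightarrow> 'v) \<Rightarrow> 'g \<Rightarrow> 'g \<Rightarrow> 'g \<Rightarrow> 'v" where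
  "kernel_form \<psi> x y z = \<phi> x (hom_act y \<psi> z)"

lemma kernel_map_add: "kernel_map \<psi> \<Longrightarrow> \<psi> (x + y) = \<psi> x + \<psi> y"
  by (simp add: kernel_map_def)

lemma kernel_map_minus:
  assumes "kernel_map \<psi>"
  shows "\<psi> (- x) = - \<psi> x"
proof -
  have "\<psi> 0 = 0" using kernel_map_add[OF assms, of 0 0] by simp
  then show ?thesis
    using kernel_map_add[OF assms, of x "- x"] by (simp add: eq_neg_iff_add_eq_0 add.commute)
qed

lemma kernel_map_diff: "kernel_map \<psi> \<Longrightarrow> \<psi> (x - y) = \<psi> x - \<psi> y"
  using kernel_map_add[of \<psi> x "- y"] kernel_map_minus[of \<psi> y] by simp

text \<open>Polarization of x psi(x) = 0 at x + y.\<close>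

lemma kernel_map_skew:
  assumes "kernel_map \<psi>"
  shows "\<phi> x (\<psi> y) = - \<phi> y (\<psi> x)"
proof -
  have "\<phi> (x + y) (\<psi> (x + y)) = 0" "\<phi> x (\<psi> x) = 0" "\<phi> y (\<psi> y) = 0"
    using assms unfolding kernel_map_def by blast+
  then show ?thesis
    by (simp add: kernel_map_add[OF assms] rep_add rep_add_right eq_neg_iff_add_eq_0 add.commute)
qed

text \<open>By skewness - x psi[z, x] = [z, x] psi(x), so x (z.psi)(x) = x z psi(x) + [z, x] psi(x)
  = z x psi(x) = 0.\<close>

lemma kernel_map_hom_act:
  assumes "kernel_map \<psi>"
  shows "kernel_map (hom_act z \<psi>)"
proof -
  have "\<phi> x (hom_act z \<psi> x) = 0" for x
  proof -
    have "\<phi> x (\<psi> (bracket z x)) = - \<phi> (bracket z x) (\<psi> x)"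
      by (rule kernel_map_skew[OF assms])
    moreover have "\<phi> x (\<psi> x) = 0" using assms by (simp add: kernel_map_def)
    ultimately show ?thesis
      by (simp add: hom_act_def rep_diff_right rep_bracket)
  qed
  then show ?thesis
    by (simp add: kernel_map_def hom_act_def kernel_map_add[OF assms] bracket_add_right
        rep_add_right algebra_simps)
qed

lemma hom_act_skew:
  assumes "kernel_map \<psi>"
  shows "hom_act x \<psi> y = - hom_act y \<psi> x"
  using kernel_map_skew[OF assms, of x y] kernel_map_minus[OF assms, of "bracket y x"]
    bracket_skew[of x y]
  by (simp add: hom_act_def)

lemma hom_act_bracket:
  assumes "kernel_map \<psi>"
  shows "hom_act (bracket x y) \<psi> z = hom_act x (hom_act y \<psi>) z - hom_act y (hom_act x \<psi>) z"
  by (simp add: hom_act_def rep_bracket rep_diff_right bracket_bracket_left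
      kernel_map_diff[OF assms] algebra_simps)

section \<open>Identities of the alternating form T_psi\<close>

lemma kernel_form_skew12:
  assumes "kernel_map \<psi>"
  shows "kernel_form \<psi> x y z = - kernel_form \<psi> y x z"
  \<comment> \<open>x (y.psi)(z) = - x (z.psi)(y) = y (z.psi)(x) = - y (x.psi)(z); the middle
    equality uses that z.psi is again a kernel map.\<close>
  unfolding kernel_form_def
  using kernel_map_skew[OF kernel_map_hom_act[OF assms, of z], of x y]
    hom_act_skew[OF assms, of y z] hom_act_skew[OF assms, of x z]
  by (simp add: rep_minus_right)

lemma kernel_form_skew23:
  assumes "kernel_map \<psi>"
  shows "kernel_form \<psi> x y z = - kernel_form \<psi> x z y"
  unfolding kernel_form_def
  using hom_act_skew[OF assms, of y z] by (simp add: rep_minus_right)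

lemma kernel_form_rotate:
  assumes "kernel_map \<psi>"
  shows "kernel_form \<psi> x y z = kernel_form \<psi> y z x"
  using kernel_form_skew12[OF assms, of x y z] kernel_form_skew23[OF assms, of y x z] by simp

text \<open>Rotation moves the bracket into the first slot, where it acts as a commutator.\<close>

lemma kernel_form_bracket:
  assumes "kernel_map \<psi>"
  shows "kernel_form \<psi> w x (bracket y z) =
    \<phi> y (kernel_form \<psi> z w x) - \<phi> z (kernel_form \<psi> y w x)"
proof -
  have "kernel_form \<psi> w x (bracket y z) = kernel_form \<psi> (bracket y z) w x"
    using kernel_form_rotate[OF assms] by metis
  then show ?thesis by (simp add: kernel_form_def rep_bracket)
qed

text \<open>Evaluate ([y, x].psi)(z) twice: as a commutator of actions, and by skewness as
  (z.psi)[x, y]. The two terms of the commutator without brackets agree up to sign and add up to the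
  double.\<close>

lemma kernel_form_double:
  assumes "kernel_map \<psi>"
  shows "kernel_form \<psi> y x z + kernel_form \<psi> y x z =
    hom_act x \<psi> (bracket y z) + hom_act y \<psi> (bracket z x) + hom_act z \<psi> (bracket x y)"
proof -
  have "hom_act (bracket y x) \<psi> z =
      \<phi> y (hom_act x \<psi> z) - hom_act x \<psi> (bracket y z)
      - (\<phi> x (hom_act y \<psi> z) - hom_act y \<psi> (bracket x z))"
    unfolding hom_act_bracket[OF assms] by (simp add: hom_act_def[of y "hom_act x \<psi>"]
        hom_act_def[of x "hom_act y \<psi>"])
  moreover have "hom_act (bracket y x) \<psi> z = hom_act z \<psi> (bracket x y)"
    using hom_act_skew[OF assms, of "bracket y x" z] bracket_skew[of y x]
      kernel_map_minus[OF kernel_map_hom_act[OF assms, of z], of "bracket x y"] by simp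
  moreover have "hom_act y \<psi> (bracket x z) = - hom_act y \<psi> (bracket z x)"
    using bracket_skew[of x z]
      kernel_map_minus[OF kernel_map_hom_act[OF assms, of y], of "bracket z x"] by simp
  moreover have "\<phi> x (hom_act y \<psi> z) = - \<phi> y (hom_act x \<psi> z)"
    using kernel_form_skew12[OF assms, of x y z] by (simp add: kernel_form_def)
  ultimately show ?thesis
    by (simp add: kernel_form_def algebra_simps)
qed

lemma double_eq_zero:
  assumes "(2 :: 'a) \<noteq> 0" "v + v = (0 :: 'v)"
  shows "v = 0"
proof -
  have "scaleV 2 v = v + v"
    using V.scale_left_distrib[of 1 1 v] by simp
  with assms show ?thesis by simp
qed

lemma kernel_form_alternating_sum:
  assumes two: "(2 :: 'a) \<noteq> 0" and ker: "kernel_map \<psi>"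
  shows "\<phi> w (kernel_form \<psi> x y z) - \<phi> x (kernel_form \<psi> w y z)
    + \<phi> y (kernel_form \<psi> w x z) - \<phi> z (kernel_form \<psi> w x y) = 0"
    (is "?A - ?B + ?C - ?D = 0")
proof (rule double_eq_zero[OF two])
  note rot = kernel_form_rotate[OF ker]
  note skew = kernel_form_skew12[OF ker] kernel_form_skew23[OF ker]
  \<comment> \<open>Applying w to \<open>kernel_form_double\<close> puts each bracket into a slot of
    T_psi, where \<open>kernel_form_bracket\<close> expands it. Each term of the alternating sum
    then occurs twice.\<close>
  have "\<phi> w (kernel_form \<psi> y x z) + \<phi> w (kernel_form \<psi> y x z)
    = \<phi> w (hom_act x \<psi> (bracket y z) + hom_act y \<psi> (bracket z x) + hom_act z \<psi> (bracket x y))"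
    by (metis kernel_form_double[OF ker] rep_add_right)
  also have "\<dots> = kernel_form \<psi> w x (bracket y z) + kernel_form \<psi> w y (bracket z x)
      + kernel_form \<psi> w z (bracket x y)"
    by (simp add: kernel_form_def rep_add_right)
  also have "\<dots> = \<phi> y (kernel_form \<psi> z w x) - \<phi> z (kernel_form \<psi> y w x)
      + (\<phi> z (kernel_form \<psi> x w y) - \<phi> x (kernel_form \<psi> z w y))
      + (\<phi> x (kernel_form \<psi> y w z) - \<phi> y (kernel_form \<psi> x w z))"
    by (simp only: kernel_form_bracket[OF ker])
  finally have eq: "\<phi> w (kernel_form \<psi> y x z) + \<phi> w (kernel_form \<psi> y x z) = \<dots>" .
  have s: "kernel_form \<psi> y x z = - kernel_form \<psi> x y z"
    "kernel_form \<psi> z w x = kernel_form \<psi> w x z"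
    "kernel_form \<psi> y w x = kernel_form \<psi> w x y"
    "kernel_form \<psi> x w y = - kernel_form \<psi> w x y"
    "kernel_form \<psi> z w y = kernel_form \<psi> w y z"
    "kernel_form \<psi> y w z = - kernel_form \<psi> w y z"
    "kernel_form \<psi> x w z = - kernel_form \<psi> w x z"
    by (rule rot skew)+
  have "- ?A - ?A = ?C - ?D + (- ?D - ?B) + (- ?B + ?C)"
    using eq unfolding s rep_minus_right by (simp add: algebra_simps)
  then show "?A - ?B + ?C - ?D + (?A - ?B + ?C - ?D) = 0"
    by (simp add: algebra_simps)
qed

text \<open>Unfolding gives w T_psi(y, x, z) - T_psi(w, x, [y, z]), which expands to three of the
  four terms of the alternating sum; the fourth is the right-hand side.\<close>

lemma kernel_form_hom_act:
  assumes two: "(2 :: 'a) \<noteq> 0" and ker: "kernel_map \<psi>"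
  shows "kernel_form (hom_act x \<psi>) w y z = - \<phi> x (kernel_form \<psi> w y z)"
proof -
  note rot = kernel_form_rotate[OF ker]
  note skew = kernel_form_skew12[OF ker] kernel_form_skew23[OF ker]
  have "kernel_form (hom_act x \<psi>) w y z
      = \<phi> w (kernel_form \<psi> y x z) - kernel_form \<psi> w x (bracket y z)"
    by (simp add: kernel_form_def hom_act_def[of y "hom_act x \<psi>"] rep_diff_right)
  also have "\<dots> = \<phi> w (kernel_form \<psi> y x z)
      - (\<phi> y (kernel_form \<psi> z w x) - \<phi> z (kernel_form \<psi> y w x))"
    by (simp only: kernel_form_bracket[OF ker])
  also have "\<dots> = - \<phi> w (kernel_form \<psi> x y z)
      - (\<phi> y (kernel_form \<psi> w x z) - \<phi> z (kernel_form \<psi> w x y))"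
  proof -
    have "kernel_form \<psi> y x z = - kernel_form \<psi> x y z"
      "kernel_form \<psi> z w x = kernel_form \<psi> w x z"
      "kernel_form \<psi> y w x = kernel_form \<psi> w x y"
      by (rule rot skew)+
    then show ?thesis by (simp only: rep_minus_right)
  qed
  also have "\<dots> = - \<phi> x (kernel_form \<psi> w y z)"
    using kernel_form_alternating_sum[OF two ker, of w x y z] by (simp add: algebra_simps)
  finally show ?thesis .
qed

lemma derived_kills_kernel_form:
  assumes two: "(2 :: 'a) \<noteq> 0" and ker: "kernel_map \<psi>"
  shows "\<phi> (bracket u v) (kernel_form \<psi> x y z) = 0"
proof (rule double_eq_zero[OF two])
  \<comment> \<open>Acting twice produces two signs, which cancel.\<close>
  have kv: "kernel_form (hom_act u (hom_act v \<psi>)) x y z = \<phi> u (\<phi> v (kernel_form \<psi> x y z))"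
    for u v
    by (simp add: kernel_form_hom_act[OF two kernel_map_hom_act[OF ker]]
        kernel_form_hom_act[OF two ker] rep_minus_right)
  have "hom_act (bracket u v) \<psi>
      = (\<lambda>z. hom_act u (hom_act v \<psi>) z - hom_act v (hom_act u \<psi>) z)"
    using hom_act_bracket[OF ker] by auto
  then have "kernel_form (hom_act (bracket u v) \<psi>) x y z
      = kernel_form (hom_act u (hom_act v \<psi>)) x y z - kernel_form (hom_act v (hom_act u \<psi>)) x y z"
    by (simp add: kernel_form_def hom_act_def[of y] rep_diff_right)
  also have "\<dots> = \<phi> (bracket u v) (kernel_form \<psi> x y z)"
    by (simp add: kv rep_bracket)
  \<comment> \<open>Acting once by [u, v] produces a single sign, so the value equals its own
    negative.\<close>
  finally show "\<phi> (bracket u v) (kernel_form \<psi> x y z)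
      + \<phi> (bracket u v) (kernel_form \<psi> x y z) = 0"
    unfolding kernel_form_hom_act[OF two ker] by (metis add.left_inverse)
qed

section \<open>Kernel maps as isomorphisms from the adjoint module\<close>

lemma kernel_map_hom:
  assumes two: "(2 :: 'a) \<noteq> 0" and ker: "kernel_map \<psi>"
    and irr: irreducible_rep and faith: faithful and nab: "bracket a b \<noteq> 0"
  shows "\<psi> (bracket x y) = \<phi> x (\<psi> y)"
proof -
  \<comment> \<open>Two passes: [g, g] kills z (x.psi)(y), so this vanishes for every z; hence
    (x.psi)(y) is itself invariant and vanishes.\<close>
  have "\<phi> z (hom_act x \<psi> y) = 0" for z
    unfolding kernel_form_def[symmetric]
    by (rule derived_invariants_zero[OF irr faith nab]) (rule derived_kills_kernel_form[OF two ker])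
  then have "hom_act x \<psi> y = 0"
    by (rule invariants_zero[OF irr faith nab])
  then show ?thesis by (simp add: hom_act_def)
qed

lemma adjoint_hom_bij:
  assumes lin: "Vector_Spaces.linear scale scaleV \<psi>" and nz: "\<psi> x0 \<noteq> 0"
    and hom: "\<And>x y. \<psi> (bracket x y) = \<phi> x (\<psi> y)"
    and irr: irreducible_rep and faith: faithful
  shows "bij \<psi>"
proof (rule bijI)
  interpret L: Vector_Spaces.linear scale scaleV \<psi> by (rule lin)
  have "V.subspace (range \<psi>)" by (rule L.subspace_image) simp
  moreover have "\<phi> x w \<in> range \<psi>" if "w \<in> range \<psi>" for x w
    using that hom[symmetric] by auto
  ultimately have "range \<psi> = {0} \<or> range \<psi> = UNIV"
    by (rule irreducible_subspace_cases[OF irr])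
  then show surj: "range \<psi> = UNIV" using nz by blast
  \<comment> \<open>If psi(x) = 0, then x psi(y) = - y psi(x) = 0 for all y; as psi is onto, x kills
    V.\<close>
  have "x = 0" if "\<psi> x = 0" for x
  proof (rule faithful_eq_zero[OF faith])
    fix v
    obtain y where "v = \<psi> y" using surj by blast
    moreover have "\<phi> x (\<psi> y) = - \<phi> y (\<psi> x)"
      unfolding hom[symmetric] by (metis bracket_skew L.neg)
    ultimately show "\<phi> x v = 0" using that by simp
  qed
  then show "inj \<psi>" by (simp add: L.inj_iff_eq_0)
qed

text \<open>Ideals are the submodules of the adjoint module, and psi carries them to submodules of
  the irreducible V.\<close>

lemma simple_if_iso_adjoint:
  assumes lin: "Vector_Spaces.linear scale scaleV \<psi>" and "bij \<psi>"
    and hom: "\<And>x y. \<psi> (bracket x y) = \<phi> x (\<psi> y)"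
    and irr: irreducible_rep and nab: "\<exists>x y. bracket x y \<noteq> 0"
  shows simple
  unfolding simple_def
proof (intro conjI allI impI nab)
  interpret L: Vector_Spaces.linear scale scaleV \<psi> by (rule lin)
  fix I assume I: "ideal I"
  have "V.subspace (\<psi> ` I)"
    using I by (intro L.subspace_image) (simp add: ideal_def)
  moreover have "\<phi> x w \<in> \<psi> ` I" if "w \<in> \<psi> ` I" for x w
    using that I hom[symmetric] by (auto simp: ideal_def)
  ultimately consider "\<psi> ` I = {0}" | "\<psi> ` I = UNIV"
    using irreducible_subspace_cases[OF irr] by blast
  then show "I = {0} \<or> I = UNIV"
  proof cases
    case 1
    then have "\<psi> ` I = \<psi> ` {0}" by (simp only: image_insert image_empty L.zero)
    then show ?thesis using \<open>bij \<psi>\<close> by (metis bij_is_inj inj_image_eq_iff)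
  next
    case 2
    then have "\<psi> ` I = \<psi> ` UNIV" using \<open>bij \<psi>\<close> by (simp add: bij_is_surj)
    then show ?thesis using \<open>bij \<psi>\<close> by (metis bij_is_inj inj_image_eq_iff)
  qed
qed

end

text \<open>A kernel vector gives a map from the adjoint module to V, whereas
  \<open>rep_isomorphic\<close> asks for one out of V.\<close>

lemma rep_isomorphicI_inv:
  assumes lin: "Vector_Spaces.linear scaleW scaleV f" and "bij f"
    and hom: "\<And>x w. f (\<rho> x w) = \<phi> x (f w)"
  shows "rep_isomorphic scaleV \<phi> scaleW \<rho>"
proof -
  interpret L: Vector_Spaces.linear scaleW scaleV f by (rule lin)
  have inv: "inv f (f w) = w" "f (inv f v) = v" for v w
    using \<open>bij f\<close> by (simp_all add: bij_is_inj bij_is_surj surj_f_inv_f)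
  have "Vector_Spaces.linear scaleV scaleW (inv f)"
  proof unfold_locales
    show "inv f (v + w) = inv f v + inv f w" for v w
      by (metis inv L.add)
    show "inv f (scaleV c v) = scaleW c (inv f v)" for c v
      by (metis inv L.scale)
  qed
  moreover have "inv f (\<phi> x v) = \<rho> x (inv f v)" for x v
    by (metis inv hom)
  ultimately show ?thesis
    unfolding rep_isomorphic_def using bij_imp_bij_inv[OF \<open>bij f\<close>] by blast
qed

section \<open>The characteristic and the matrix encoding\<close>

lemma two_neq_zero:
  assumes "CHAR('a::field) \<noteq> 2"
  shows "(2 :: 'a) \<noteq> 0"
proof
  assume "(2 :: 'a) = 0"
  then have "of_nat 2 = (0 :: 'a)" by simp
  then have "CHAR('a) dvd 2" by (simp only: of_nat_eq_0_iff_char_dvd)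
  then have "CHAR('a) = 1 \<or> CHAR('a) = 2"
    using two_is_prime_nat by (meson prime_nat_iff)
  then show False using assms CHAR_not_1' by auto
qed

lemma row_matrix_add:
  assumes "\<And>v. S v = T v + U v"
  shows "row_matrix S = row_matrix T + row_matrix U"
  by (simp add: vec_eq_iff row_matrix_def matrix_def transpose_def assms)

lemma row_matrix_scale:
  assumes "\<And>v. S v = c *s T v"
  shows "row_matrix S = (\<chi> i. c *s (row_matrix T $ i))"
  by (simp add: vec_eq_iff row_matrix_def matrix_def transpose_def assms)

section \<open>The equivalence for matrix spaces\<close>

theorem theorem1p3:
  fixes scale :: "'a::alg_closed_field \<Rightarrow> 'g::ab_group_add \<Rightarrow> 'g"
    and bracket :: "'g \<Rightarrow> 'g \<Rightarrow> 'g"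
    and \<phi> :: "'g \<Rightarrow> 'a ^ 'n \<Rightarrow> 'a ^ 'n"
    and B :: "('a ^ 'n ^ 'n) set"
  assumes "CHAR('a) \<noteq> 2" and "CHAR('a) \<noteq> 3"
    and "lie_algebra scale bracket"
    and "lie_algebra.semisimple scale bracket"
    and "lie_representation scale bracket (*s) \<phi>"
    and "lie_representation.faithful \<phi>"
    and "lie_representation.irreducible_rep (*s) \<phi>"
    and "B = rep_image \<phi>"
  shows "(\<exists>\<psi>. linear_kernel_vector B \<psi>) \<longleftrightarrow>
         trivial_matrix_lie_algebra B \<or>
         (lie_algebra.simple scale bracket \<and>
          rep_isomorphic (*s) \<phi> scale (lie_algebra.ad bracket))"
proof -
  interpret R: lie_representation scale bracket "(*s)" \<phi> by fact
  note irr = \<open>R.irreducible_rep\<close> and faith = \<open>R.faithful\<close>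
  have two: "(2 :: 'a) \<noteq> 0" using \<open>CHAR('a) \<noteq> 2\<close> by (rule two_neq_zero)
  obtain a b where nab: "bracket a b \<noteq> 0"
    using R.semisimple_nonabelian \<open>R.semisimple\<close> by blast
  let ?M = "\<lambda>x. row_matrix (\<phi> x)"
  have B: "B = range ?M" using \<open>B = rep_image \<phi>\<close> by (simp add: rep_image_def)
  have M_in: "?M x \<in> B" for x unfolding B by (rule rangeI)
  have M: "v v* ?M x = \<phi> x v" for v x
    by (rule row_matrix_works) (rule R.rep_linear)
  have M_add: "?M (x + y) = ?M x + ?M y" for x y
    by (rule row_matrix_add) (rule R.rep_add)
  have M_scale: "?M (scale c x) = (\<chi> i. c *s (?M x $ i))" for c x
    by (rule row_matrix_scale) (rule R.rep_scale)
  have inj_M: "inj ?M"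
  proof (rule injI)
    fix x y assume "?M x = ?M y"
    then have "\<phi> x = \<phi> y" by (metis M ext)
    then show "x = y" using faith by (simp add: R.faithful_def inj_eq)
  qed
  \<comment> \<open>Faithfulness makes the image of a non-zero algebra non-zero, which rules out the
    first alternative.\<close>
  have nontrivial: "\<not> trivial_matrix_lie_algebra B"
  proof
    assume "trivial_matrix_lie_algebra B"
    then have "?M x = 0" for x
      using M_in[of x] by (simp add: trivial_matrix_lie_algebra_def)
    then have "?M (bracket a b) = ?M 0" by simp
    with inj_M have "bracket a b = 0" by (rule injD)
    with nab show False ..
  qed
  have "R.simple \<and> rep_isomorphic (*s) \<phi> scale R.ad" if psi: "linear_kernel_vector B \<psi>" for \<psi>
  proof -
    \<comment> \<open>Pulling psi back to g turns the row-vector condition into x p(x) = 0.\<close>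
    let ?p = "\<lambda>x. \<psi> (?M x)"
    have p_add: "?p (x + y) = ?p x + ?p y" for x y
      using psi M_in unfolding linear_kernel_vector_def M_add by blast
    have p_scale: "?p (scale c x) = c *s ?p x" for c x
      using psi M_in unfolding linear_kernel_vector_def M_scale by blast
    have "\<phi> x (?p x) = 0" for x
    proof -
      have "?p x v* ?M x = 0"
        using psi M_in unfolding linear_kernel_vector_def by blast
      then show ?thesis by (simp only: M)
    qed
    then have "R.kernel_map ?p"
      by (simp add: R.kernel_map_def p_add)
    then have hom: "?p (bracket x y) = \<phi> x (?p y)" for x y
      by (rule R.kernel_map_hom[OF two _ irr faith nab])
    have lin: "Vector_Spaces.linear scale (*s) ?p"
      by unfold_locales (simp_all add: p_add p_scale)
    obtain x0 where "?p x0 \<noteq> 0"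
      using psi unfolding linear_kernel_vector_def B by blast
    with lin have "bij ?p" using hom irr faith by (rule R.adjoint_hom_bij)
    then have "R.simple"
      using nab by (intro R.simple_if_iso_adjoint[OF lin _ hom irr]) auto
    moreover have "rep_isomorphic (*s) \<phi> scale R.ad"
      using lin \<open>bij ?p\<close> by (rule rep_isomorphicI_inv) (simp add: R.ad_def hom)
    ultimately show ?thesis ..
  qed
  moreover have "\<exists>\<psi>. linear_kernel_vector B \<psi>" if iso: "rep_isomorphic (*s) \<phi> scale R.ad"
  proof -
    obtain f where lin: "Vector_Spaces.linear (*s) scale f" and "bij f"
      and hom: "\<And>x v. f (\<phi> x v) = bracket x (f v)"
      using iso unfolding rep_isomorphic_def R.ad_def by blast
    interpret L: Vector_Spaces.linear "(*s)" scale f by (rule lin)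
    have inv: "inv f (f v) = v" "f (inv f x) = x" for v x
      using \<open>bij f\<close> by (simp_all add: bij_is_inj bij_is_surj surj_f_inv_f)
    \<comment> \<open>Recover x from its matrix and send it to V by the inverse isomorphism; values
      outside \<open>B\<close> are arbitrary. The kernel condition becomes [x, x] = 0.\<close>
    define \<psi> where "\<psi> A = inv f (inv ?M A)" for A
    have psi: "\<psi> (?M x) = inv f x" for x
      unfolding \<psi>_def using inv_f_f[OF inj_M, of x] by simp
    have "inv f (x + y) = inv f x + inv f y" for x y
      by (metis inv L.add)
    then have "\<psi> (?M x + ?M y) = \<psi> (?M x) + \<psi> (?M y)" for x y
      by (simp add: psi flip: M_add)
    moreover have "inv f (scale c x) = c *s inv f x" for c x
      by (metis inv L.scale)
    then have "\<psi> (\<chi> i. c *s (?M x $ i)) = c *s \<psi> (?M x)" for c x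
      by (simp add: psi flip: M_scale)
    moreover have "\<psi> (?M (bracket a b)) \<noteq> 0"
      using nab by (metis psi inv(2) L.zero)
    moreover have "\<psi> (?M x) v* ?M x = 0" for x
    proof -
      have "f (\<phi> x (inv f x)) = f 0" by (simp add: hom inv R.bracket_self)
      then show ?thesis by (metis M psi inv(1))
    qed
    ultimately have "linear_kernel_vector B \<psi>"
      unfolding linear_kernel_vector_def B by auto
    then show ?thesis by blast
  qed
  ultimately show ?thesis using nontrivial by blast
qed

end
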